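(* For every $p$ with $1<p<2$, let $x_p$ be the unique solution in $(1,\infty)$ of $x^p=2x+1$ and set $$C_p=\frac{\sqrt{x_p(x_p+1)}}{(x_p^p+1)^{1/p}} .$$ Then there exist a finite-dimensional complex Hilbert space $\mathcal H$ and $A,B\in\mathcal B(\mathcal H)$ such that $$\|A+B\|_p> C_p\,\bigl\||A|+|B|\bigr\|_p .$$
   Context: $\mathcal B(\mathcal H)$ is the space of linear operators on $\mathcal H$. For $A\in\mathcal B(\mathcal H)$, $|A|=(A^*A)^{1/2}$, and $\|A\|_p=(\operatorname{Tr}|A|^p)^{1/p}$ is the Schatten $p$-norm. *)

theory Defs
  imports Complex_Main "Jordan_Normal_Form.Schur_Decomposition"
begin

text \<open>
  A finite-dimensional complex Hilbert space is taken in coordinates, as $\mathbf C^n$ with its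
  standard inner product: operators are complex \<open>n \<times> n\<close> matrices, and the adjoint is the conjugate
  transpose \<^const>\<open>mat_adjoint\<close>.
\<close>

definition mat_trace :: "complex mat \<Rightarrow> complex" where
  "mat_trace A = (\<Sum>i<dim_row A. A $$ (i, i))"

text \<open>
  Spectral functional calculus \<open>M \<mapsto> M\<^sup>r\<close> for positive semidefinite \<open>M\<close>.
  It is meant for \<open>r > 0\<close> only, where \<open>0 powr r = 0\<close> is the right value on the kernel of \<open>M\<close>.
\<close>

definition is_psd_powr :: "complex mat \<Rightarrow> real \<Rightarrow> complex mat \<Rightarrow> bool" where
  "is_psd_powr M r N \<longleftrightarrow> (\<exists>n U d.
     M \<in> carrier_mat n n \<and> U \<in> carrier_mat n n \<and> mat_adjoint U * U = 1\<^sub>m n \<and>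
     (\<forall>i<n. 0 \<le> (d i :: real)) \<and>
     M = U * mat_diag n (\<lambda>i. complex_of_real (d i)) * mat_adjoint U \<and>
     N = U * mat_diag n (\<lambda>i. complex_of_real (d i powr r)) * mat_adjoint U)"

definition psd_powr :: "complex mat \<Rightarrow> real \<Rightarrow> complex mat" where
  "psd_powr M r = (THE N. is_psd_powr M r N)"

definition mat_abs :: "complex mat \<Rightarrow> complex mat" where
  "mat_abs A = psd_powr (mat_adjoint A * A) (1 / 2)"

definition schatten_norm :: "real \<Rightarrow> complex mat \<Rightarrow> real" where
  "schatten_norm p A = Re (mat_trace (psd_powr (mat_abs A) p)) powr (1 / p)"

definition x_sol :: "real \<Rightarrow> real" where
  "x_sol p = (THE x. 1 < x \<and> x powr p = 2 * x + 1)"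

definition C_const :: "real \<Rightarrow> real" where
  "C_const p = sqrt (x_sol p * (x_sol p + 1)) / (x_sol p powr p + 1) powr (1 / p)"

text \<open>
  The definite descriptions above: \<open>N\<close> does not depend on the diagonalization chosen (it exists for
  every positive semidefinite \<open>M\<close> by the spectral theorem), and \<open>x_sol p\<close> exists and is unique.
\<close>

lemma mat_adjoint_carrier: "U \<in> carrier_mat n m \<Longrightarrow> mat_adjoint U \<in> carrier_mat m n"
  unfolding mat_adjoint_def by (auto simp: mat_of_rows_def)

lemma is_psd_powr_unique:
  assumes "is_psd_powr M r N" and "is_psd_powr M r N'"
  shows "N = N'"
proof -
  obtain n U d where M: "M \<in> carrier_mat n n" and U: "U \<in> carrier_mat n n"
    and UU: "mat_adjoint U * U = 1\<^sub>m n" and d: "\<forall>i<n. 0 \<le> (d i :: real)"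
    and MU: "M = U * mat_diag n (\<lambda>i. complex_of_real (d i)) * mat_adjoint U"
    and NU: "N = U * mat_diag n (\<lambda>i. complex_of_real (d i powr r)) * mat_adjoint U"
    using assms(1) unfolding is_psd_powr_def by blast
  obtain m V e where M': "M \<in> carrier_mat m m" and V': "V \<in> carrier_mat m m"
    and VV': "mat_adjoint V * V = 1\<^sub>m m"
    and MV': "M = V * mat_diag m (\<lambda>i. complex_of_real (e i)) * mat_adjoint V"
    and NV': "N' = V * mat_diag m (\<lambda>i. complex_of_real (e i powr r)) * mat_adjoint V"
    using assms(2) unfolding is_psd_powr_def by blast
  have mn: "m = n" using M M' by auto
  note V = V'[unfolded mn] and VV = VV'[unfolded mn] and MV = MV'[unfolded mn]
    and NV = NV'[unfolded mn]
  define Us where "Us = mat_adjoint U"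
  define Vs where "Vs = mat_adjoint V"
  define D where "D = mat_diag n (\<lambda>i. complex_of_real (d i))"
  define E where "E = mat_diag n (\<lambda>i. complex_of_real (e i))"
  define D' where "D' = mat_diag n (\<lambda>i. complex_of_real (d i powr r))"
  define E' where "E' = mat_diag n (\<lambda>i. complex_of_real (e i powr r))"
  define W where "W = Vs * U"
  have c[simp]: "Us \<in> carrier_mat n n" "Vs \<in> carrier_mat n n" "U \<in> carrier_mat n n"
    "V \<in> carrier_mat n n" "D \<in> carrier_mat n n" "E \<in> carrier_mat n n"
    "D' \<in> carrier_mat n n" "E' \<in> carrier_mat n n" "W \<in> carrier_mat n n"
    using U V mat_adjoint_carrier[OF U] mat_adjoint_carrier[OF V]
    by (auto simp: Us_def Vs_def D_def E_def D'_def E'_def W_def intro: mult_carrier_mat)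
  have UsU: "Us * U = 1\<^sub>m n" and VsV: "Vs * V = 1\<^sub>m n"
    using UU VV by (auto simp: Us_def Vs_def)
  have UUs: "U * Us = 1\<^sub>m n" and VVs: "V * Vs = 1\<^sub>m n"
    using UsU VsV mat_mult_left_right_inverse[of Us n U] mat_mult_left_right_inverse[of Vs n V]
    by auto
  note assoc = assoc_mult_mat[of _ n n _ n _ n] right_mult_one_mat[of _ n n]
    left_mult_one_mat[of _ n n] mult_carrier_mat[of _ n n _ n]
  have eq: "U * D * Us = V * E * Vs"
    using MU MV by (simp add: Us_def Vs_def D_def E_def)
  have "W * D = Vs * (U * D * (Us * U))" by (simp add: UsU W_def assoc)
  also have "\<dots> = Vs * (U * D * Us) * U" by (simp add: assoc)
  also have "\<dots> = (Vs * V) * E * (Vs * U)" unfolding eq by (simp add: assoc)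
  also have "\<dots> = E * W" by (simp add: VsV W_def assoc)
  finally have WD: "W * D = E * W" .
  have ent: "W $$ (i, j) * complex_of_real (d j) = complex_of_real (e i) * W $$ (i, j)"
    if "i < n" "j < n" for i j
    using arg_cong[OF WD, of "\<lambda>X. X $$ (i, j)"] that
    unfolding D_def E_def mat_diag_mult_left[OF c(9)] mat_diag_mult_right[OF c(9)] by simp
  have WD': "W * D' = E' * W"
  proof (rule eq_matI)
    fix i j assume "i < dim_row (E' * W)" "j < dim_col (E' * W)"
    then have ij: "i < n" "j < n" using c by (metis carrier_matD index_mult_mat(2,3))+
    have "W $$ (i, j) = 0 \<or> d j = e i" using ent[OF ij] by auto
    then show "(W * D') $$ (i, j) = (E' * W) $$ (i, j)"
      unfolding D'_def E'_def mat_diag_mult_left[OF c(9)] mat_diag_mult_right[OF c(9)]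
      using ij by auto
  qed (use c in \<open>metis carrier_matD index_mult_mat(2,3)\<close>)+
  have "N = (V * Vs) * U * D' * Us" by (simp add: NU VVs D'_def[symmetric] Us_def[symmetric] assoc)
  also have "\<dots> = V * (W * D') * Us" by (simp add: assoc W_def)
  also have "\<dots> = V * E' * Vs * (U * Us)" unfolding WD' by (simp add: assoc W_def)
  also have "\<dots> = N'" by (simp add: UUs NV E'_def[symmetric] Vs_def[symmetric] assoc)
  finally show ?thesis .
qed

lemma psd_powr_eqI: "is_psd_powr M r N \<Longrightarrow> psd_powr M r = N"
  unfolding psd_powr_def by (blast intro: is_psd_powr_unique)

lemma x_sol_ex1:
  assumes "1 < p"
  shows "\<exists>!x::real. 1 < x \<and> x powr p = 2 * x + 1"
proof -
  define g where "g x = x powr (p - 1) - 2 - 1 / x" for x :: real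
  have iff: "x powr p = 2 * x + 1 \<longleftrightarrow> g x = 0" if "1 < x" for x
  proof -
    have "x powr p = x * x powr (p - 1)"
      using that powr_mult_base[of x "p - 1"] by simp
    then have "x powr p - (2 * x + 1) = x * g x"
      using that by (simp add: g_def field_simps)
    then show ?thesis using that by (metis eq_iff_diff_eq_0 mult_eq_0_iff not_one_less_zero)
  qed
  have mono: "g x < g y" if "1 < x" "x < y" for x y
  proof -
    have "x powr (p - 1) < y powr (p - 1)" using that assms by (intro powr_less_mono2) auto
    moreover have "1 / y < 1 / x" using that by (simp add: frac_less2)
    ultimately show ?thesis by (simp add: g_def)
  qed
  define X where "X = (3::real) powr (1 / (p - 1))"
  have X: "1 < X" using assms by (auto simp: X_def intro!: gr_one_powr)
  have "g X = 1 - 1 / X" using assms by (simp add: g_def X_def powr_powr)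
  then have gX: "0 \<le> g X" using X by simp
  have g1: "g 1 = -2" by (simp add: g_def)
  have "continuous_on {1..X} g" unfolding g_def by (intro continuous_intros) auto
  then have "\<exists>x\<ge>1. x \<le> X \<and> g x = 0"
    using IVT'[of g 1 0 X] g1 gX X by auto
  then obtain x where x: "1 \<le> x" "g x = 0" by blast
  with g1 have "1 < x" by (cases "x = 1") auto
  with x iff have "1 < x \<and> x powr p = 2 * x + 1" by blast
  moreover have "y = x" if "1 < y \<and> y powr p = 2 * y + 1" for y
    using mono[of x y] mono[of y x] iff[of y] that x \<open>1 < x\<close> by force
  ultimately show ?thesis by blast
qed

end

theory Submission
  imports Defs
begin

text \<open>
  Take rank-one \<open>A = u a\<^sup>T\<close> and \<open>B = v b\<^sup>T\<close> in dimension 2 with unit vectors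
  \<open>a = (\<alpha>, \<beta>)\<close>, \<open>b = (\<alpha>, -\<beta>)\<close>, \<open>u = (cos \<theta>, sin \<theta>)\<close>, \<open>v = (cos \<theta>, -sin \<theta>)\<close>. Then
  \<open>|A| + |B| = diag (2\<alpha>\<^sup>2, 2\<beta>\<^sup>2)\<close> does not depend on \<open>\<theta>\<close>, while
  \<open>A + B = diag (2\<alpha> cos \<theta>, 2\<beta> sin \<theta>)\<close>. With \<open>\<alpha>\<^sup>2/\<beta>\<^sup>2 = x\<^sub>p\<close>, the ratio of the two norms is
  exactly \<open>C\<^sub>p\<close> at \<open>\<theta> = 0\<close>. For small \<open>\<theta> > 0\<close> the first singular value loses only order \<open>\<theta>\<^sup>2\<close>,
  and the second contributes order \<open>\<theta>\<^sup>p\<close>, which dominates because \<open>p < 2\<close>.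
\<close>

definition real_mat2 :: "real \<Rightarrow> real \<Rightarrow> real \<Rightarrow> real \<Rightarrow> complex mat" where
  "real_mat2 a b c d = mat 2 2 (\<lambda>(i, j). complex_of_real
     (if i = 0 then if j = 0 then a else b else if j = 0 then c else d))"

lemma real_mat2_carrier [simp]: "real_mat2 a b c d \<in> carrier_mat 2 2"
  by (simp add: real_mat2_def)

lemma real_mat2_adjoint [simp]: "mat_adjoint (real_mat2 a b c d) = real_mat2 a c b d"
  by (rule eq_matI) (auto simp: mat_adjoint_def real_mat2_def mat_of_rows_def)

lemma real_mat2_mult [simp]:
  "real_mat2 a b c d * real_mat2 a' b' c' d' =
   real_mat2 (a * a' + b * c') (a * b' + b * d') (c * a' + d * c') (c * b' + d * d')"
  by (rule eq_matI) (auto simp: real_mat2_def scalar_prod_def numeral_2_eq_2)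

lemma real_mat2_add [simp]:
  "real_mat2 a b c d + real_mat2 a' b' c' d' = real_mat2 (a + a') (b + b') (c + c') (d + d')"
  by (rule eq_matI) (auto simp: real_mat2_def)

lemma real_mat2_one: "1\<^sub>m 2 = real_mat2 1 0 0 1"
  by (rule eq_matI) (auto simp: real_mat2_def)

lemma real_mat2_diag:
  "mat_diag 2 (\<lambda>i. complex_of_real (f i)) = real_mat2 (f 0) 0 0 (f 1)"
  by (rule eq_matI) (auto simp: real_mat2_def mat_diag_def less_2_cases_iff)

lemma mat_trace_real_mat2: "mat_trace (real_mat2 a b c d) = complex_of_real (a + d)"
  by (simp add: mat_trace_def real_mat2_def numeral_2_eq_2)

text \<open>The rotation with columns \<open>(c, s)\<close> and \<open>(- s, c)\<close> diagonalizes
  the matrix with eigenvalues \<open>d\<close> and \<open>e\<close>, so the power acts on these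
  alone.\<close>

lemma psd_powr_real_mat2:
  assumes "c\<^sup>2 + s\<^sup>2 = 1" "0 \<le> d" "0 \<le> e"
  shows "psd_powr (real_mat2 (c\<^sup>2 * d + s\<^sup>2 * e) (c * s * (d - e)) (c * s * (d - e)) (s\<^sup>2 * d + c\<^sup>2 * e)) r
    = real_mat2 (c\<^sup>2 * d powr r + s\<^sup>2 * e powr r) (c * s * (d powr r - e powr r))
        (c * s * (d powr r - e powr r)) (s\<^sup>2 * d powr r + c\<^sup>2 * e powr r)"
proof -
  define U where "U = real_mat2 c (- s) s c"
  define f where "f = (\<lambda>i::nat. if i = 0 then d else e)"
  have "mat_adjoint U * U = 1\<^sub>m 2"
    using assms(1) by (simp add: U_def real_mat2_one power2_eq_square add.commute)
  \<comment> \<open>Stated for arbitrary \<open>g\<close>, since it is needed both for the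
    eigenvalues and for their powers.\<close>
  moreover have conj: "U * mat_diag 2 (\<lambda>i. complex_of_real (g i)) * mat_adjoint U =
      real_mat2 (c\<^sup>2 * g 0 + s\<^sup>2 * g 1) (c * s * (g 0 - g 1)) (c * s * (g 0 - g 1))
        (s\<^sup>2 * g 0 + c\<^sup>2 * g 1)" for g
    by (simp add: U_def real_mat2_diag power2_eq_square algebra_simps)
  ultimately show ?thesis
    using assms(2,3) conj[of f] conj[of "\<lambda>i. f i powr r"]
    by (intro psd_powr_eqI, unfold is_psd_powr_def,
        intro exI[of _ "2::nat"] exI[of _ U] exI[of _ f]) (simp add: U_def f_def)
qed

lemma psd_powr_diag2:
  assumes "0 \<le> d" "0 \<le> e"
  shows "psd_powr (real_mat2 d 0 0 e) r = real_mat2 (d powr r) 0 0 (e powr r)"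
  using psd_powr_real_mat2[of 1 0 d e r] assms by simp

text \<open>For a unit vector \<open>(u, v)\<close>, the product of the adjoint with the matrix is
  the orthogonal projection onto the line of \<open>(a, b)\<close>. Its eigenvalues 1 and 0 are
  fixed by the square root.\<close>

lemma mat_abs_rank_one:
  assumes "u\<^sup>2 + v\<^sup>2 = 1" "a\<^sup>2 + b\<^sup>2 = 1"
  shows "mat_abs (real_mat2 (u * a) (u * b) (v * a) (v * b))
    = real_mat2 (a\<^sup>2) (a * b) (a * b) (b\<^sup>2)"
proof -
  have *: "u * y * (u * z) + v * y * (v * z) = y * z" for y z
  proof -
    have "u * y * (u * z) + v * y * (v * z) = (u\<^sup>2 + v\<^sup>2) * (y * z)"
      by (simp add: power2_eq_square algebra_simps)
    then show ?thesis by (simp add: assms(1))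
  qed
  show ?thesis
    using psd_powr_real_mat2[of a b 1 0 "1/2"] assms(2)
    by (simp add: mat_abs_def * power2_eq_square mult.commute[of b a])
qed

lemma schatten_norm_diag2:
  assumes "0 \<le> d" "0 \<le> e"
  shows "schatten_norm p (real_mat2 d 0 0 e) = (d powr p + e powr p) powr (1 / p)"
  using assms by (simp add: schatten_norm_def mat_abs_def psd_powr_diag2 mat_trace_real_mat2
      powr_half_sqrt)

text \<open>Compare with \<open>c\<^sup>2 + s\<^sup>2 = 1\<close>: as c \<le> 1 and p < 2, passing
  from exponent 2 to p does not decrease the first term, and for small s the term
  \<open>r * s powr p\<close> exceeds \<open>s\<^sup>2\<close>.\<close>

lemma cos_powr_sin_powr_gt_one:
  assumes "1 < p" "p < 2" "0 < r" "r < 1"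
  shows "\<exists>c s::real. 0 < c \<and> 0 < s \<and> c\<^sup>2 + s\<^sup>2 = 1 \<and> 1 < c powr p + r * s powr p"
proof -
  \<comment> \<open>Solves \<open>s powr (2 - p) = r / 2\<close>; the factor 1/2 makes the
    comparison with r strict.\<close>
  define s where "s = (r / 2) powr (1 / (2 - p))"
  have s0: "0 < s" using assms by (simp add: s_def)
  have "s < 1 powr (1 / (2 - p))" unfolding s_def using assms by (intro powr_less_mono2) auto
  then have s1: "s < 1" by simp
  have "s powr (2 - p) = r / 2" using assms by (simp add: s_def powr_powr)
  then have "s\<^sup>2 = s powr p * (r / 2)"
    using s0 powr_add[of s p "2 - p"] by simp
  also have "\<dots> < r * s powr p" using s0 assms by simp
  finally have *: "s\<^sup>2 < r * s powr p" .
  define c where "c = sqrt (1 - s\<^sup>2)"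
  have "s\<^sup>2 < 1" using s0 s1 by (simp add: power_less_one_iff)
  then have c: "0 < c" "c\<^sup>2 = 1 - s\<^sup>2" by (auto simp: c_def)
  have "c \<le> 1" by (simp add: c_def)
  then have "c powr 2 \<le> c powr p" using assms c(1) by (intro powr_mono') auto
  then have "1 < c powr p + r * s powr p" using * c by simp
  with s0 c show ?thesis by (intro exI[of _ c] exI[of _ s]) simp
qed

theorem mainTheorem3:
  fixes p :: real
  assumes "1 < p" and "p < 2"
  shows "\<exists>n. \<exists>A \<in> carrier_mat n n. \<exists>B \<in> carrier_mat n n.
    schatten_norm p (A + B) > C_const p * schatten_norm p (mat_abs A + mat_abs B)"
proof -
  define x where "x = x_sol p"
  have x: "1 < x"
    using theI'[OF x_sol_ex1[OF assms(1)]] unfolding x_def x_sol_def by blast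
  define \<alpha> where "\<alpha> = sqrt (x / (x + 1))"
  define \<beta> where "\<beta> = sqrt (1 / (x + 1))"
  have \<alpha>: "0 < \<alpha>" "\<alpha>\<^sup>2 = x / (x + 1)" and \<beta>: "0 < \<beta>" "\<beta>\<^sup>2 = 1 / (x + 1)"
    using x by (auto simp: \<alpha>_def \<beta>_def)
  have unit: "\<alpha>\<^sup>2 + \<beta>\<^sup>2 = 1" using x by (simp add: \<alpha> \<beta> add_divide_distrib[symmetric])
  have "\<beta> < \<alpha>" using x unfolding \<alpha>_def \<beta>_def by (simp add: divide_strict_right_mono)
  \<comment> \<open>The weight left on \<open>s powr p\<close> once
    \<open>(2 * \<alpha>) powr p\<close> is factored out of the p-th power of the norm of
    \<open>A + B\<close>.\<close>
  define r where "r = (\<beta> / \<alpha>) powr p"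
  have "0 < r" using \<alpha> \<beta> by (simp add: r_def)
  have "r < 1 powr p"
    unfolding r_def using \<alpha> \<beta> \<open>\<beta> < \<alpha>\<close> assms by (intro powr_less_mono2) auto
  then have "r < 1" by simp
  obtain c s :: real where c: "0 < c" and s: "0 < s" and cs: "c\<^sup>2 + s\<^sup>2 = 1"
    and gt: "1 < c powr p + r * s powr p"
    using cos_powr_sin_powr_gt_one[OF assms \<open>0 < r\<close> \<open>r < 1\<close>] by blast
  define A where "A = real_mat2 (c * \<alpha>) (c * \<beta>) (s * \<alpha>) (s * \<beta>)"
  \<comment> \<open>Flipping the signs of \<beta> and s together cancels the off-diagonal entries
    both in \<open>A + B\<close> and in the sum of the absolute values.\<close>
  define B where "B = real_mat2 (c * \<alpha>) (c * (- \<beta>)) ((- s) * \<alpha>) ((- s) * (- \<beta>))"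
  have sum: "A + B = real_mat2 (2 * \<alpha> * c) 0 0 (2 * \<beta> * s)"
    by (simp add: A_def B_def algebra_simps)
  have "mat_abs A = real_mat2 (\<alpha>\<^sup>2) (\<alpha> * \<beta>) (\<alpha> * \<beta>) (\<beta>\<^sup>2)"
    unfolding A_def by (rule mat_abs_rank_one[OF cs unit])
  moreover have "mat_abs B = real_mat2 (\<alpha>\<^sup>2) (\<alpha> * - \<beta>) (\<alpha> * - \<beta>) ((- \<beta>)\<^sup>2)"
    unfolding B_def by (rule mat_abs_rank_one) (use cs unit in auto)
  ultimately have abs: "mat_abs A + mat_abs B = real_mat2 (2 / (x + 1) * x) 0 0 (2 / (x + 1))"
    by (simp add: \<alpha> \<beta>)
  have "schatten_norm p (mat_abs A + mat_abs B) =
      ((2 / (x + 1)) powr p * (x powr p + 1)) powr (1 / p)"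
    unfolding abs using x
    by (subst schatten_norm_diag2) (simp_all only: powr_mult distrib_left, auto)
  also have "\<dots> = 2 / (x + 1) * (x powr p + 1) powr (1 / p)"
    using x assms by (subst powr_mult) (simp_all add: powr_powr)
  \<comment> \<open>The denominator of \<open>C_const p\<close> cancels the factor
    \<open>(x powr p + 1) powr (1 / p)\<close>.\<close>
  finally have "C_const p * schatten_norm p (mat_abs A + mat_abs B)
      = sqrt (x * (x + 1)) * (2 / (x + 1))"
    using x by (simp add: C_const_def x_def[symmetric] add_nonneg_eq_0_iff)
  \<comment> \<open>This is the norm that \<open>A + B\<close> would have at c = 1, s = 0.\<close>
  also have "\<dots> = 2 * \<alpha>"
  proof -
    have "(\<alpha> * (x + 1))\<^sup>2 = x * (x + 1)"
      using x unfolding power_mult_distrib \<alpha>(2) by (simp add: power2_eq_square)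
    then have "sqrt (x * (x + 1)) = \<alpha> * (x + 1)"
      using \<alpha>(1) x by (intro real_sqrt_unique) auto
    then show ?thesis using x by simp
  qed
  also have "\<dots> = ((2 * \<alpha>) powr p) powr (1 / p)" using \<alpha> assms by (simp add: powr_powr)
  also have "\<dots> < ((2 * \<alpha> * c) powr p + (2 * \<beta> * s) powr p) powr (1 / p)"
  proof (rule powr_less_mono2)
    have "(2 * \<alpha>) powr p * r = (2 * \<beta>) powr p"
      using \<alpha> \<beta> by (simp add: r_def powr_mult powr_divide)
    then have "(2 * \<alpha> * c) powr p + (2 * \<beta> * s) powr p
        = (2 * \<alpha>) powr p * (c powr p + r * s powr p)"
      by (simp add: powr_mult[of "2 * \<alpha>" c] powr_mult[of "2 * \<beta>" s] distrib_left
          mult.assoc[symmetric])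
    moreover have "(2 * \<alpha>) powr p * 1 < (2 * \<alpha>) powr p * (c powr p + r * s powr p)"
      using gt \<alpha> by (intro mult_strict_left_mono) auto
    ultimately show "(2 * \<alpha>) powr p < (2 * \<alpha> * c) powr p + (2 * \<beta> * s) powr p" by simp
  qed (use assms in auto)
  also have "\<dots> = schatten_norm p (A + B)"
    unfolding sum using \<alpha> \<beta> c s by (simp add: schatten_norm_diag2)
  finally have "C_const p * schatten_norm p (mat_abs A + mat_abs B) < schatten_norm p (A + B)" .
  moreover have "A \<in> carrier_mat 2 2" "B \<in> carrier_mat 2 2" by (simp_all add: A_def B_def)
  ultimately show ?thesis by blast
qed

end
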